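(* Let $G$ be a graph on $n$ vertices, $k$ a positive integer and $\mathcal{F}$ a layered family of $G$ with thickness at most $k$, with set of centers $\mathcal{C}_{\mathcal{F}}$. Let $X\subseteq\mathcal{C}_{\mathcal{F}}$, and let $f$ be the optimum value of the following linear program in nonnegative variables $\rho_u$, $\eta_{u,v}$, $\gamma_{u,v,P}$ ($u,v\in X$, $P\in\mathcal{P}_{u,v}$, where $\mathcal{P}_{u,v}$ is the set of induced $u$--$v$ paths in $G$): maximize $\frac{|X|}{10}\sum_{u\in X}\rho_u-\sum_{u,v\in X}\eta_{u,v}$ subject to $\rho_u-\eta_{u,v}-\sum_{P\in\mathcal{P}_{u,v}}\gamma_{u,v,P}\le 0$ for all $u,v\in X$, and $\sum_{u,v\in X}\sum_{P\in\mathcal{P}_{u,v},\,P\cap F\ne\emptyset}\gamma_{u,v,P}\le 1$ for all $F\in\mathcal{F}$. Suppose $f>0$. Then for every positive integer $\ell\ge 7(f\log n+|X|+2)$ there exists an induced subgraph $H$ of $G$ with $X\subseteq V(H)$ such that: every $(X,\frac12)$-balanced separator $S$ in $H$ satisfies $\mathrm{cov}_{\mathcal{F}}(S)\ge f$; and $|F\cap V(H)|\le 1+\frac{3\ell}{5f}(2k-1)$ for every $F\in\mathcal{F}$.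
   Context: Logarithms are base 2. Layered family: given an ordered partition $\Pi=(L_1,\dots,L_m)$ of $V(G)$, the layer digraph has an arc $(u,v)$ iff $uv\in E(G)$, $u\in L_i$, $v\in L_j$, $j<i$. $v$ is a descendant of $u$ if there is a directed path from $u$ to $v$ (including $v=u$). For each vertex $u$ with no in-arcs, the set of $u$ and all its descendants belongs to $\mathcal{F}$, with center $u$; $\mathcal{C}_{\mathcal{F}}$ is the set of centers. Thickness: smallest $k$ such that every member meets at most $k$ parts of $\Pi$. An $(X,\phi)$-balanced separator in $H$ is a set $S\subseteq V(H)$ such that every component of $H-S$ contains at most $\phi|X|$ vertices of $X$. $\mathrm{cov}_{\mathcal{F}}(S)$ is the minimum number of members of $\mathcal{F}$ whose union contains $S$. *)

theory Defs
  imports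
    Complex_Main
    "HOL-Library.Disjoint_Sets"
    "Graph_Theory.Digraph_Component"
    "Graph_Theory.Vertex_Walk"
begin

text \<open>
  A finite simple graph is a \<open>('a, 'b) pre_digraph\<close> satisfying the predicate \<^const>\<open>graph\<close>:
  finite, loop-free, without parallel arcs, and symmetric, an undirected edge being represented
  by its two arcs.
\<close>

definition ordered_partition :: "'a set list \<Rightarrow> 'a set \<Rightarrow> bool" where
  "ordered_partition Ls A \<longleftrightarrow> distinct Ls \<and> partition_on A (set Ls)"

definition layer_digraph :: "('a, 'b) pre_digraph \<Rightarrow> 'a set list \<Rightarrow> ('a, 'a \<times> 'a) pre_digraph" where
  "layer_digraph G Ls = with_proj
     \<lparr> pverts = verts G,
       parcs = {(u, v). u \<rightarrow>\<^bsub>G\<^esub> v \<and> (\<exists>i j. i < length Ls \<and> j < i \<and> u \<in> Ls ! i \<and> v \<in> Ls ! j)} \<rparr>"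

definition descendants :: "('a, 'b) pre_digraph \<Rightarrow> 'a \<Rightarrow> 'a set" where
  "descendants D u = {v. u \<rightarrow>\<^sup>*\<^bsub>D\<^esub> v}"

definition layer_centers :: "('a, 'b) pre_digraph \<Rightarrow> 'a set list \<Rightarrow> 'a set" where
  "layer_centers G Ls = {u \<in> verts G. in_arcs (layer_digraph G Ls) u = {}}"

definition layered_family :: "('a, 'b) pre_digraph \<Rightarrow> 'a set list \<Rightarrow> 'a set set" where
  "layered_family G Ls = descendants (layer_digraph G Ls) ` layer_centers G Ls"

definition thickness :: "('a, 'b) pre_digraph \<Rightarrow> 'a set list \<Rightarrow> nat" where
  "thickness G Ls =
     (LEAST k. \<forall>F \<in> layered_family G Ls. card {L \<in> set Ls. L \<inter> F \<noteq> {}} \<le> k)"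

text \<open>
  A path is given by its list of vertices. A \<open>u\<close>--\<open>v\<close> path is traversed from \<open>u\<close> to \<open>v\<close>, so
  each undirected path occurs exactly once; for \<open>u = v\<close> the only path is \<open>[u]\<close>.
\<close>

definition induced_paths :: "('a, 'b) pre_digraph \<Rightarrow> 'a \<Rightarrow> 'a \<Rightarrow> 'a list set" where
  "induced_paths G u v =
     {P. vpath P G \<and> hd P = u \<and> last P = v \<and>
         (\<forall>i < length P. \<forall>j < length P. P ! i \<rightarrow>\<^bsub>G\<^esub> P ! j \<longrightarrow> j = Suc i \<or> i = Suc j)}"

definition lp_feasible ::
  "('a, 'b) pre_digraph \<Rightarrow> 'a set set \<Rightarrow> 'a set \<Rightarrow>
   ('a \<Rightarrow> real) \<Rightarrow> ('a \<Rightarrow> 'a \<Rightarrow> real) \<Rightarrow> ('a \<Rightarrow> 'a \<Rightarrow> 'a list \<Rightarrow> real) \<Rightarrow> bool" where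
  "lp_feasible G \<F> X \<rho> \<eta> \<gamma> \<longleftrightarrow>
     (\<forall>u \<in> X. 0 \<le> \<rho> u) \<and>
     (\<forall>u \<in> X. \<forall>v \<in> X. 0 \<le> \<eta> u v) \<and>
     (\<forall>u \<in> X. \<forall>v \<in> X. \<forall>P \<in> induced_paths G u v. 0 \<le> \<gamma> u v P) \<and>
     (\<forall>u \<in> X. \<forall>v \<in> X. \<rho> u - \<eta> u v - (\<Sum>P \<in> induced_paths G u v. \<gamma> u v P) \<le> 0) \<and>
     (\<forall>F \<in> \<F>. (\<Sum>u \<in> X. \<Sum>v \<in> X. \<Sum>P \<in> {P \<in> induced_paths G u v. set P \<inter> F \<noteq> {}}. \<gamma> u v P) \<le> 1)"

definition lp_objective :: "'a set \<Rightarrow> ('a \<Rightarrow> real) \<Rightarrow> ('a \<Rightarrow> 'a \<Rightarrow> real) \<Rightarrow> real" where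
  "lp_objective X \<rho> \<eta> = real (card X) / 10 * (\<Sum>u \<in> X. \<rho> u) - (\<Sum>u \<in> X. \<Sum>v \<in> X. \<eta> u v)"

definition lp_optimum :: "('a, 'b) pre_digraph \<Rightarrow> 'a set set \<Rightarrow> 'a set \<Rightarrow> real \<Rightarrow> bool" where
  "lp_optimum G \<F> X f \<longleftrightarrow>
     (\<exists>\<rho> \<eta> \<gamma>. lp_feasible G \<F> X \<rho> \<eta> \<gamma> \<and> lp_objective X \<rho> \<eta> = f) \<and>
     (\<forall>\<rho> \<eta> \<gamma>. lp_feasible G \<F> X \<rho> \<eta> \<gamma> \<longrightarrow> lp_objective X \<rho> \<eta> \<le> f)"

text \<open>
  For a symmetric digraph, the strongly connected components (as subgraphs) are exactly the
  connected components of the undirected graph.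
\<close>

definition balanced_separator ::
  "('a, 'b) pre_digraph \<Rightarrow> 'a set \<Rightarrow> real \<Rightarrow> 'a set \<Rightarrow> bool" where
  "balanced_separator H X \<phi> S \<longleftrightarrow>
     S \<subseteq> verts H \<and>
     (\<forall>C \<in> pre_digraph.sccs (H \<restriction> (verts H - S)). real (card (verts C \<inter> X)) \<le> \<phi> * real (card X))"

text \<open>
  The minimum below is over a nonempty set whenever \<open>\<F>\<close> is a layered family of \<open>G\<close> and
  \<open>S \<subseteq> verts G\<close>: the layer digraph is finite and acyclic, so every vertex is a descendant of
  some center.
\<close>

definition cov :: "'a set set \<Rightarrow> 'a set \<Rightarrow> nat" where
  "cov \<F> S = (LEAST m. \<exists>\<A> \<subseteq> \<F>. finite \<A> \<and> card \<A> = m \<and> S \<subseteq> \<Union>\<A>)"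

end

theory Submission
  imports Defs
begin

text \<open>
  In an optimal LP solution make every constraint \<open>\<rho> u - \<eta> u v - \<Sum>\<gamma> u v P \<le> 0\<close> an equality. The weights
  \<open>\<gamma>\<close> then have total mass at least \<open>10 f\<close> and define a probability distribution on paths; sample \<open>l\<close>
  paths. A member of the family is hit by a single sample with probability at most \<open>1 / (10 f)\<close>, so
  all members are hit at most \<open>3 l / (5 f)\<close> times. For a subfamily \<open>\<A>\<close> with at most \<open>f\<close> members and
  \<open>A \<subseteq> X\<close> with \<open>card X / 3 \<le> card A \<le> 2 card X / 3\<close>, a sample joins \<open>A\<close> to \<open>X - A\<close> and
  avoids \<open>\<Union>\<A>\<close> with probability at least \<open>7 / 30\<close>, so some sampled path does so for all pairs
  \<open>(\<A>, A)\<close> simultaneously. The sampling is derandomised by the method of conditional expectations.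
  Replacing each sampled path by a walk that hits no new member and meets each member in at most
  \<open>2 k - 1\<close> vertices, \<open>H\<close> is induced by \<open>X\<close> and these walks. If \<open>S\<close> were a balanced separator of \<open>H\<close> with
  cover number below \<open>f\<close>, then grouping the components of \<open>H - S\<close> and the single vertices of
  \<open>X \<inter> S\<close> would give a set \<open>A\<close> that no walk avoiding \<open>S\<close> can leave.
\<close>

section \<open>Averaging, balanced grouping and elementary facts on walks\<close>

text \<open>Method of conditional expectations: for independent samples drawn with law
  \<open>p\<close>, the expectation of the left-hand sum is at most the right-hand one. The entries
  are fixed one at a time; the factor \<open>g i w\<close> of the chosen entry is absorbed into the
  weight \<open>a i\<close>, so \<open>a\<close> has to vary in the induction.\<close>

lemma exists_list_prod_le_average:
  fixes p :: "'w \<Rightarrow> real" and a c :: "'i \<Rightarrow> real" and g :: "'i \<Rightarrow> 'w \<Rightarrow> real"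
  assumes "finite W" "finite I"
    and p: "\<And>w. w \<in> W \<Longrightarrow> 0 \<le> p w" "sum p W = 1"
    and a: "\<And>i. i \<in> I \<Longrightarrow> 0 \<le> a i"
    and g: "\<And>i w. i \<in> I \<Longrightarrow> w \<in> W \<Longrightarrow> 0 \<le> g i w"
    and c: "\<And>i. i \<in> I \<Longrightarrow> (\<Sum>w\<in>W. p w * g i w) \<le> c i"
  shows "\<exists>ws. length ws = l \<and> set ws \<subseteq> W \<and>
    (\<Sum>i\<in>I. a i * (\<Prod>w\<leftarrow>ws. g i w)) \<le> (\<Sum>i\<in>I. a i * c i ^ l)"
  using a
proof (induction l arbitrary: a)
  case 0
  then show ?case by (intro exI[of _ "[]"]) simp
next
  case (Suc l)
  have c0: "0 \<le> c i" if "i \<in> I" for i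
    using order_trans[OF sum_nonneg c[OF that]] p(1) g that by simp
  \<comment> \<open>If every \<open>w\<close> exceeded the bound, then so would the
    \<open>p\<close>-average, contrary to the choice of \<open>c\<close>.\<close>
  have "\<exists>w\<in>W. (\<Sum>i\<in>I. a i * g i w * c i ^ l) \<le> (\<Sum>i\<in>I. a i * c i ^ Suc l)"
  proof (rule ccontr)
    assume "\<not> ?thesis"
    then have less: "(\<Sum>i\<in>I. a i * c i ^ Suc l) < (\<Sum>i\<in>I. a i * g i w * c i ^ l)" if "w \<in> W" for w
      using that by force
    let ?m = "\<Sum>i\<in>I. a i * c i ^ Suc l"
    obtain w0 where w0: "w0 \<in> W" "p w0 > 0"
      using p by (metis less_eq_real_def sum.neutral zero_neq_one)
    have "?m = (\<Sum>w\<in>W. p w * ?m)"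
      using p(2) by (simp flip: sum_distrib_right)
    also have "\<dots> < (\<Sum>w\<in>W. p w * (\<Sum>i\<in>I. a i * g i w * c i ^ l))"
    proof (rule sum_strict_mono_ex1[OF \<open>finite W\<close>])
      show "\<forall>w\<in>W. p w * ?m \<le> p w * (\<Sum>i\<in>I. a i * g i w * c i ^ l)"
        using less p(1) by (blast intro: mult_left_mono less_imp_le)
      show "\<exists>w\<in>W. p w * ?m < p w * (\<Sum>i\<in>I. a i * g i w * c i ^ l)"
        using less[OF w0(1)] w0 mult_strict_left_mono by blast
    qed
    also have "\<dots> = (\<Sum>i\<in>I. \<Sum>w\<in>W. p w * (a i * g i w * c i ^ l))"
      by (subst sum.swap) (simp add: sum_distrib_left)
    also have "\<dots> = (\<Sum>i\<in>I. a i * c i ^ l * (\<Sum>w\<in>W. p w * g i w))"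
      by (simp add: sum_distrib_left mult_ac)
    also have "\<dots> \<le> (\<Sum>i\<in>I. a i * c i ^ l * c i)"
      using c c0 Suc.prems by (intro sum_mono mult_left_mono) auto
    finally show False by (simp add: mult_ac)
  qed
  then obtain w where w: "w \<in> W" "(\<Sum>i\<in>I. a i * g i w * c i ^ l) \<le> (\<Sum>i\<in>I. a i * c i ^ Suc l)"
    by blast
  obtain ws where "length ws = l" "set ws \<subseteq> W"
    "(\<Sum>i\<in>I. a i * g i w * (\<Prod>w\<leftarrow>ws. g i w)) \<le> (\<Sum>i\<in>I. a i * g i w * c i ^ l)"
    using Suc.IH[of "\<lambda>i. a i * g i w"] Suc.prems g w(1) by auto
  with w show ?case by (intro exI[of _ "w # ws"]) (auto simp: mult_ac)
qed

text \<open>A fibre with at least a third of \<open>X\<close> suffices alone, as it has at most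
  half. Otherwise take a smallest set of labels covering at least a third: without one of its fibres
  it covers less than a third, and that fibre adds less than another third.\<close>

lemma exists_balanced_union_of_fibres:
  assumes "finite X" "X \<noteq> {}"
    and small: "\<And>x. x \<in> X \<Longrightarrow> 2 * card {y \<in> X. h y = h x} \<le> card X"
  obtains B where "card X \<le> 3 * card {x \<in> X. h x \<in> B}" "3 * card {x \<in> X. h x \<in> B} \<le> 2 * card X"
proof (cases "\<exists>x\<in>X. card X \<le> 3 * card {y \<in> X. h y = h x}")
  case True
  then obtain x where "x \<in> X" "card X \<le> 3 * card {y \<in> X. h y = h x}" by blast
  with small[of x] that[of "{h x}"] show ?thesis by simp
next
  case False
  let ?good = "\<lambda>B. B \<subseteq> h ` X \<and> card X \<le> 3 * card {x \<in> X. h x \<in> B}"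
  have "{x \<in> X. h x \<in> h ` X} = X" by auto
  then have "?good (h ` X)" by simp
  then obtain B where B: "?good B" and least: "\<And>B'. ?good B' \<Longrightarrow> card B \<le> card B'"
    using ex_has_least_nat[of ?good "h ` X" card] by blast
  have finB: "finite B" using B \<open>finite X\<close> finite_surj by blast
  have "B \<noteq> {}" using B assms(1,2) by (auto simp: card_gt_0_iff)
  then obtain x where x: "x \<in> X" "h x \<in> B" using B by blast
  have "\<not> ?good (B - {h x})"
    using least[of "B - {h x}"] finB x card_Diff1_less[of B "h x"] by linarith
  then have "3 * card {y \<in> X. h y \<in> B - {h x}} < card X" using B by auto
  moreover have "3 * card {y \<in> X. h y = h x} < card X" using False x by auto
  moreover have "card {y \<in> X. h y \<in> B} \<le> card {y \<in> X. h y \<in> B - {h x}} + card {y \<in> X. h y = h x}"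
    using \<open>finite X\<close> by (intro order_trans[OF card_mono card_Un_le]) auto
  ultimately show ?thesis using B that[of B] by simp
qed

text \<open>The bound \<open>1 + x \<le> exp x\<close> in base 2, with the crude estimate
  \<open>exp 1 \<le> 4\<close>.\<close>

lemma one_plus_le_two_powr:
  fixes x :: real
  assumes "0 \<le> x"
  shows "1 + x \<le> 2 powr (2 * x)"
proof -
  have "1 + x \<le> exp x" by (rule exp_ge_add_one_self)
  also have "\<dots> = exp 1 powr x" by (simp add: powr_def)
  also have "\<dots> \<le> 4 powr x" using exp_le assms by (intro powr_mono2) auto
  also have "\<dots> = (2 powr 2) powr x" by simp
  also have "\<dots> = 2 powr (2 * x)" by (subst powr_powr) simp
  finally show ?thesis .
qed

lemma vwalk_replace_middle:
  assumes "vwalk (as @ p @ bs) G" "p \<noteq> []" "vwalk q G" "hd q = hd p" "last q = last p"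
  shows "vwalk (as @ q @ bs) G"
  using assms
  by (cases "as = []"; cases "bs = []") (auto simp: vwalk_def vwalk_arcs_append)

section \<open>Levels, short descents, covers and rerouting in a layered graph\<close>

locale layered_graph = graph G for G :: "('a, 'b) pre_digraph" +
  fixes Ls :: "'a set list"
  assumes layers: "ordered_partition Ls (verts G)"
begin

abbreviation "D \<equiv> layer_digraph G Ls"

definition level :: "'a \<Rightarrow> nat" where
  "level v = (LEAST i. i < length Ls \<and> v \<in> Ls ! i)"

lemma level_eqI:
  assumes "i < length Ls" "v \<in> Ls ! i"
  shows "level v = i"
  unfolding level_def
proof (rule Least_equality)
  fix j assume j: "j < length Ls \<and> v \<in> Ls ! j"
  have "Ls ! i \<in> set Ls" "Ls ! j \<in> set Ls" using assms j by auto
  with assms j layers have "Ls ! i = Ls ! j"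
    unfolding ordered_partition_def partition_on_def disjoint_def by blast
  then show "i \<le> j"
    using assms j layers by (simp add: ordered_partition_def nth_eq_iff_index_eq)
qed (use assms in auto)

lemma level:
  assumes "v \<in> verts G"
  shows "level v < length Ls" "v \<in> Ls ! level v"
proof -
  obtain i where "i < length Ls" "v \<in> Ls ! i"
    using assms layers unfolding ordered_partition_def partition_on_def
    by (metis UnionE in_set_conv_nth)
  with level_eqI[OF this] show "level v < length Ls" "v \<in> Ls ! level v" by auto
qed

lemma dominates_layer_iff: "u \<rightarrow>\<^bsub>D\<^esub> v \<longleftrightarrow> u \<rightarrow>\<^bsub>G\<^esub> v \<and> level v < level u"
proof
  assume "u \<rightarrow>\<^bsub>D\<^esub> v"
  then obtain i j where "u \<rightarrow>\<^bsub>G\<^esub> v" "i < length Ls" "j < i" "u \<in> Ls ! i" "v \<in> Ls ! j"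
    by (auto simp: layer_digraph_def arcs_ends_def arc_to_ends_def)
  then show "u \<rightarrow>\<^bsub>G\<^esub> v \<and> level v < level u"
    using level_eqI[of i u] level_eqI[of j v] by simp
next
  assume uv: "u \<rightarrow>\<^bsub>G\<^esub> v \<and> level v < level u"
  then have "u \<in> verts G" "v \<in> verts G" by (auto simp: adj_in_verts)
  with uv level[of u] level[of v] show "u \<rightarrow>\<^bsub>D\<^esub> v"
    by (auto simp: layer_digraph_def arcs_ends_def arc_to_ends_def)
qed

lemma verts_layer [simp]: "verts D = verts G"
  by (simp add: layer_digraph_def)

sublocale D: wf_digraph D
  by unfold_locales (auto simp: layer_digraph_def adj_in_verts)

lemma reachable_level_le: "u \<rightarrow>\<^sup>*\<^bsub>D\<^esub> v \<Longrightarrow> level v \<le> level u"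
  by (induction rule: D.converse_reachable_induct) (auto simp: dominates_layer_iff)

text \<open>Every arc of \<open>D\<close> strictly lowers the level, so a directed path visits a
  layer at most once.\<close>

lemma descending_walk:
  assumes "u \<rightarrow>\<^sup>*\<^bsub>D\<^esub> v"
  obtains p where "vwalk p G" "hd p = u" "last p = v"
    "\<And>w. w \<in> set p \<Longrightarrow> u \<rightarrow>\<^sup>*\<^bsub>D\<^esub> w \<and> w \<rightarrow>\<^sup>*\<^bsub>D\<^esub> v" "distinct (map level p)"
proof -
  have "\<exists>p. vwalk p G \<and> hd p = u \<and> last p = v \<and>
    (\<forall>w\<in>set p. u \<rightarrow>\<^sup>*\<^bsub>D\<^esub> w \<and> w \<rightarrow>\<^sup>*\<^bsub>D\<^esub> v) \<and> distinct (map level p)"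
    using assms
  proof (induction rule: D.converse_reachable_induct)
    case base
    then show ?case by (intro exI[of _ "[v]"]) (auto simp: vwalk_def)
  next
    case (step x y)
    then obtain p where p: "vwalk p G" "hd p = y" "last p = v"
      "\<And>w. w \<in> set p \<Longrightarrow> y \<rightarrow>\<^sup>*\<^bsub>D\<^esub> w \<and> w \<rightarrow>\<^sup>*\<^bsub>D\<^esub> v" "distinct (map level p)"
      by blast
    have "level w < level x" if "w \<in> set p" for w
      using p(4)[OF that] reachable_level_le[of y w] step(1) by (auto simp: dominates_layer_iff)
    moreover have "vwalk (x # p) G"
      using p(1,2) step(1) by (auto intro!: vwalk_consI simp: dominates_layer_iff adj_in_verts)
    moreover have "x \<rightarrow>\<^sup>*\<^bsub>D\<^esub> w" if "w \<in> set p" for w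
      using p(4)[OF that] step(1) D.adj_reachable_trans by blast
    moreover have "x \<rightarrow>\<^sup>*\<^bsub>D\<^esub> x" "x \<rightarrow>\<^sup>*\<^bsub>D\<^esub> v"
      using step(1,2) D.adj_reachable_trans D.adj_in_verts D.reachable_refl by blast+
    ultimately show ?case
      using p by (intro exI[of _ "x # p"]) (force simp: vwalk_def)
  qed
  then show thesis using that by blast
qed

lemma card_layers_le_thickness:
  assumes "F \<in> layered_family G Ls"
  shows "card {L \<in> set Ls. L \<inter> F \<noteq> {}} \<le> thickness G Ls"
proof -
  have "\<forall>F \<in> layered_family G Ls. card {L \<in> set Ls. L \<inter> F \<noteq> {}} \<le> thickness G Ls"
    unfolding thickness_def
    by (rule LeastI[of _ "card (set Ls)"]) (auto intro: card_mono)
  with assms show ?thesis by blast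
qed

text \<open>The vertices of a descending walk from \<open>c\<close> lie in different layers, and
  each of these layers meets the member with center \<open>c\<close>; the thickness bounds their
  number.\<close>

lemma short_walk_to_descendant:
  assumes c: "c \<in> layer_centers G Ls" and v: "v \<in> descendants D c"
  obtains p where "vwalk p G" "hd p = c" "last p = v" "\<And>w. w \<in> set p \<Longrightarrow> w \<rightarrow>\<^sup>*\<^bsub>D\<^esub> v"
    "length p \<le> thickness G Ls"
proof -
  obtain p where p: "vwalk p G" "hd p = c" "last p = v"
    "\<And>w. w \<in> set p \<Longrightarrow> c \<rightarrow>\<^sup>*\<^bsub>D\<^esub> w \<and> w \<rightarrow>\<^sup>*\<^bsub>D\<^esub> v" "distinct (map level p)"
    using descending_walk v unfolding descendants_def by blast
  let ?F = "descendants D c"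
  have inV: "w \<in> verts G" if "w \<in> set p" for w
    using p(1) that by (auto simp: vwalk_def)
  have "inj_on level (set p)" "distinct p"
    using p(5) by (auto simp: distinct_map)
  then have "inj_on (\<lambda>w. Ls ! level w) (set p)"
    using layers inV level by (fastforce simp: inj_on_def ordered_partition_def nth_eq_iff_index_eq)
  then have "length p = card ((\<lambda>w. Ls ! level w) ` set p)"
    using \<open>distinct p\<close> by (simp add: card_image distinct_card)
  also have "\<dots> \<le> card {L \<in> set Ls. L \<inter> ?F \<noteq> {}}"
    using inV level p(4) by (intro card_mono) (auto simp: descendants_def, blast)
  also have "\<dots> \<le> thickness G Ls"
    using c by (intro card_layers_le_thickness) (auto simp: layered_family_def)
  finally show thesis using p that by blast
qed

text \<open>No arc of \<open>D\<close> enters a center. Hence a member contains no center but its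
  own, which accounts for the summand 1 in the final bound.\<close>

lemma center_reachableD:
  assumes "c \<in> layer_centers G Ls" "u \<rightarrow>\<^sup>*\<^bsub>D\<^esub> c"
  shows "u = c"
proof -
  have "\<not> y \<rightarrow>\<^bsub>D\<^esub> c" for y
    using assms(1) by (auto simp: layer_centers_def in_arcs_def arcs_ends_def arc_to_ends_def)
  with assms(2) show ?thesis
    by (induction rule: D.reachable_induct) auto
qed

lemma layered_family_down_closed:
  assumes "F \<in> layered_family G Ls" "w \<in> F" "w \<rightarrow>\<^sup>*\<^bsub>D\<^esub> v"
  shows "v \<in> F"
  using assms D.reachable_trans by (auto simp: layered_family_def descendants_def)

text \<open>Climbing along in-arcs raises the level, which stays below \<open>length Ls\<close>, so
  the climb ends at a vertex without in-arcs.\<close>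

lemma vertex_in_layered_family_member:
  assumes "v \<in> verts G"
  obtains F where "F \<in> layered_family G Ls" "v \<in> F"
proof -
  have "\<exists>c\<in>layer_centers G Ls. c \<rightarrow>\<^sup>*\<^bsub>D\<^esub> v"
    using assms
  proof (induction "length Ls - level v" arbitrary: v rule: less_induct)
    case less
    show ?case
    proof (cases "\<exists>u. u \<rightarrow>\<^bsub>D\<^esub> v")
      case True
      then obtain u where u: "u \<rightarrow>\<^bsub>D\<^esub> v" by blast
      then have "u \<in> verts G" "level v < level u" 
        by (auto simp: dominates_layer_iff adj_in_verts)
      with level(1)[of u] less.hyps[of u] obtain c where "c \<in> layer_centers G Ls" "c \<rightarrow>\<^sup>*\<^bsub>D\<^esub> u"
        by force
      with u show ?thesis using D.reachable_adj_trans by blast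
    next
      case False
      then have "v \<in> layer_centers G Ls"
        using less.prems by (force simp: layer_centers_def in_arcs_def arcs_ends_def arc_to_ends_def)
      with less.prems show ?thesis by (intro bexI[of _ v]) auto
    qed
  qed
  then show thesis using that by (auto simp: layered_family_def descendants_def)
qed

text \<open>The \<open>LEAST\<close> in \<open>cov\<close> is attained: one member chosen for each
  vertex of \<open>S\<close> gives a finite cover.\<close>

lemma cov_cover:
  assumes "S \<subseteq> verts G"
  obtains \<A> where "\<A> \<subseteq> layered_family G Ls" "finite \<A>" "card \<A> = cov (layered_family G Ls) S"
    "S \<subseteq> \<Union>\<A>"
proof -
  have "\<forall>v\<in>S. \<exists>F. F \<in> layered_family G Ls \<and> v \<in> F"
    using assms vertex_in_layered_family_member by (metis subsetD)
  then obtain h where h: "\<forall>v\<in>S. h v \<in> layered_family G Ls \<and> v \<in> h v" by metis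
  have "\<exists>\<A> \<subseteq> layered_family G Ls. finite \<A> \<and> card \<A> = card (h ` S) \<and> S \<subseteq> \<Union>\<A>"
    using h assms finite_subset[OF assms] by (intro exI[of _ "h ` S"]) auto
  then have "\<exists>\<A> \<subseteq> layered_family G Ls. finite \<A> \<and> card \<A> = cov (layered_family G Ls) S \<and> S \<subseteq> \<Union>\<A>"
    unfolding cov_def by (rule LeastI)
  then show thesis using that by blast
qed

text \<open>
  \<open>Q\<close> is a shortest walk among those all of whose vertices lie only in members hit by \<open>P\<close>. The
  vertices above such a vertex in the layer digraph have the same property, so the part of \<open>Q\<close>
  between its first and last vertex in \<open>F\<close> can be compared with a detour through the center of \<open>F\<close>.
\<close>

lemma reroute:
  assumes "vwalk P G"
  obtains Q where "vwalk Q G" "hd Q = hd P" "last Q = last P"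
    "\<And>F. F \<in> layered_family G Ls \<Longrightarrow> set Q \<inter> F \<noteq> {} \<Longrightarrow> set P \<inter> F \<noteq> {}"
    "\<And>F. F \<in> layered_family G Ls \<Longrightarrow> card (F \<inter> set Q) \<le> 2 * thickness G Ls - 1"
proof -
  define ok where "ok w \<longleftrightarrow> (\<forall>F\<in>layered_family G Ls. w \<in> F \<longrightarrow> set P \<inter> F \<noteq> {})" for w
  define good where "good Q \<longleftrightarrow> vwalk Q G \<and> hd Q = hd P \<and> last Q = last P \<and> (\<forall>w\<in>set Q. ok w)" for Q
  \<comment> \<open>Members are closed downward, so one that contains \<open>w\<close> also contains
    \<open>v\<close>.\<close>
  have ok_up: "ok w" if "ok v" "w \<rightarrow>\<^sup>*\<^bsub>D\<^esub> v" for v w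
    using that layered_family_down_closed unfolding ok_def by blast
  have "good P"
    using assms unfolding good_def ok_def by blast
  then obtain Q where Q: "good Q" and least: "\<And>R. good R \<Longrightarrow> length Q \<le> length R"
    using ex_has_least_nat[of good P length] by blast
  have "card (F \<inter> set Q) \<le> 2 * thickness G Ls - 1" if F: "F \<in> layered_family G Ls" for F
  proof (cases "\<exists>w\<in>set Q. w \<in> F")
    case False
    then have "F \<inter> set Q = {}" by blast
    then show ?thesis by simp
  next
    case True
    obtain c where c: "c \<in> layer_centers G Ls" "F = descendants D c"
      using F by (auto simp: layered_family_def)
    \<comment> \<open>With \<open>a\<close> the first and \<open>b\<close> the last vertex of
      \<open>Q\<close> in \<open>F\<close>, the segment from \<open>a\<close> to \<open>b\<close>
      contains all of \<open>F \<inter> set Q\<close>.\<close>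
    obtain as a rest where as: "Q = as @ a # rest" "a \<in> F" "\<forall>w\<in>set as. w \<notin> F"
      using split_list_first_prop[OF True] by metis
    have ex: "\<exists>w\<in>set (a # rest). w \<in> F" using as by auto
    obtain bs b ds where bs: "a # rest = bs @ b # ds" "b \<in> F" "\<forall>w\<in>set ds. w \<notin> F"
      using split_list_last_prop[OF ex] by blast
    let ?M = "bs @ [b]"
    have QM: "Q = as @ ?M @ ds" using as bs by simp
    have hdM: "hd ?M = a" using bs(1) by (cases bs) auto
    have "a \<in> set Q" using as(1) by simp
    moreover have "b \<in> set Q" unfolding QM by simp
    ultimately have ok: "ok a" "ok b" using Q unfolding good_def by auto
    obtain p where p: "vwalk p G" "hd p = c" "last p = a" "\<And>w. w \<in> set p \<Longrightarrow> w \<rightarrow>\<^sup>*\<^bsub>D\<^esub> a"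
      "length p \<le> thickness G Ls"
      using short_walk_to_descendant c as(2) by blast
    obtain q where q: "vwalk q G" "hd q = c" "last q = b" "\<And>w. w \<in> set q \<Longrightarrow> w \<rightarrow>\<^sup>*\<^bsub>D\<^esub> b"
      "length q \<le> thickness G Ls"
      using short_walk_to_descendant c bs(2) by blast
    have ne: "p \<noteq> []" "q \<noteq> []" using p q by auto
    have join: "joinable (rev p) q"
      using ne p q by (simp add: joinable_def last_rev)
    let ?R = "rev p \<oplus> q"
    have R: "vwalk ?R G" "hd ?R = a" "last ?R = b"
      using vwalk_joinI_vwalk[OF vwalk_rev_ex[OF sym_arcs p(1)] q(1) join]
        vwalk_join_hd[OF join] vwalk_join_last[OF join] p q ne
      by (auto simp: hd_rev)
    have setR: "set ?R \<subseteq> set p \<union> set q"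
      using ne by (auto simp: vwalk_join_def dest: list.set_sel(2))
    have M: "vwalk (as @ ?M @ ds) G" "hd (as @ ?M @ ds) = hd P" "last (as @ ?M @ ds) = last P"
      "\<forall>w\<in>set (as @ ?M @ ds). ok w"
      using Q unfolding good_def QM by blast+
    have "?R \<noteq> []" using ne by simp
    have "vwalk (as @ ?R @ ds) G"
      by (rule vwalk_replace_middle[OF M(1)]) (use R hdM in simp_all)
    moreover have "hd (as @ ?R @ ds) = hd P"
      using M(2) R(2) hdM \<open>?R \<noteq> []\<close> by (cases as) (simp_all add: hd_append split: if_splits)
    moreover have "last (as @ ?R @ ds) = last P"
      using M(3) R(3) \<open>?R \<noteq> []\<close> by (cases "ds = []") simp_all
    moreover have "ok w" if "w \<in> set (as @ ?R @ ds)" for w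
    proof (cases "w \<in> set p \<union> set q")
      case True
      then show ?thesis using p(4) q(4) ok ok_up by blast
    next
      case False
      then show ?thesis using that setR M(4) by auto
    qed
    ultimately have "good (as @ ?R @ ds)" by (simp add: good_def)
    then have "length Q \<le> length (as @ ?R @ ds)" by (rule least)
    then have "length ?M \<le> length ?R" unfolding QM by simp
    \<comment> \<open>The two halves of the detour share the center, which is counted once; this is
      the \<open>- 1\<close> in the bound.\<close>
    moreover have "length ?R = length p + length q - 1"
      using ne by (cases q) (auto simp: vwalk_join_def)
    ultimately have "length ?M \<le> 2 * thickness G Ls - 1"
      using p(5) q(5) by simp
    moreover have "F \<inter> set Q \<subseteq> set ?M" using as(3) bs(3) unfolding QM by auto
    ultimately show ?thesis
      by (meson List.finite_set card_length card_mono order_trans)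
  qed
  moreover have "set P \<inter> F \<noteq> {}" if "F \<in> layered_family G Ls" "set Q \<inter> F \<noteq> {}" for F
    using Q that unfolding good_def ok_def by blast
  ultimately show thesis using that Q unfolding good_def by blast
qed

end

section \<open>Tight optimal solutions of the linear program\<close>

text \<open>Cap \<open>\<eta> u v\<close> at \<open>\<rho> u\<close>, which cannot lower the
  objective, and then scale the weights of the \<open>u\<close>-\<open>v\<close> paths down to
  equality. Smaller weights keep the constraints of the members, and optimality forces the value to
  stay \<open>f\<close>.\<close>

lemma lp_optimum_tight:
  assumes opt: "lp_optimum G \<F> X f"
  obtains \<rho> \<eta> \<gamma> where "lp_feasible G \<F> X \<rho> \<eta> \<gamma>" "lp_objective X \<rho> \<eta> = f"
    "\<And>u v. u \<in> X \<Longrightarrow> v \<in> X \<Longrightarrow> (\<Sum>P\<in>induced_paths G u v. \<gamma> u v P) = \<rho> u - \<eta> u v"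
proof -
  obtain \<rho> \<eta> \<gamma> where feas: "lp_feasible G \<F> X \<rho> \<eta> \<gamma>" and obj: "lp_objective X \<rho> \<eta> = f"
    using opt by (auto simp: lp_optimum_def)
  define \<eta>' where "\<eta>' u v = min (\<eta> u v) (\<rho> u)" for u v
  define s where "s u v = (\<Sum>P\<in>induced_paths G u v. \<gamma> u v P)" for u v
  \<comment> \<open>If \<open>s u v = 0\<close>, then \<open>\<rho> u - \<eta>' u v\<close> is 0 as
    well, so the value 0 of the division is the right one.\<close>
  define t where "t u v = (\<rho> u - \<eta>' u v) / s u v" for u v
  define \<gamma>' where "\<gamma>' u v P = \<gamma> u v P * t u v" for u v P
  have s0: "0 \<le> s u v" if "u \<in> X" "v \<in> X" for u v
    using feas that by (auto simp: s_def lp_feasible_def intro: sum_nonneg)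
  have le: "0 \<le> \<rho> u - \<eta>' u v" "\<rho> u - \<eta>' u v \<le> s u v" if "u \<in> X" "v \<in> X" for u v
    using feas that s0[OF that] by (auto simp: s_def \<eta>'_def lp_feasible_def min_def)
  have t: "0 \<le> t u v" "t u v \<le> 1" if "u \<in> X" "v \<in> X" for u v
    using le[OF that] s0[OF that] by (auto simp: t_def divide_le_eq_1)
  have tight: "(\<Sum>P\<in>induced_paths G u v. \<gamma>' u v P) = \<rho> u - \<eta>' u v" if "u \<in> X" "v \<in> X" for u v
  proof -
    have "(\<Sum>P\<in>induced_paths G u v. \<gamma>' u v P) = s u v * t u v"
      by (simp add: \<gamma>'_def s_def sum_distrib_right)
    also have "\<dots> = \<rho> u - \<eta>' u v"
      using le[OF that] by (auto simp: t_def)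
    finally show ?thesis .
  qed
  have \<gamma>': "0 \<le> \<gamma>' u v P" "\<gamma>' u v P \<le> \<gamma> u v P"
    if "u \<in> X" "v \<in> X" "P \<in> induced_paths G u v" for u v P
    using feas that t[OF that(1,2)]
    by (auto simp: \<gamma>'_def lp_feasible_def intro: mult_right_le_one_le)
  have "(\<Sum>u\<in>X. \<Sum>v\<in>X. \<Sum>P \<in> {P \<in> induced_paths G u v. set P \<inter> F \<noteq> {}}. \<gamma>' u v P) \<le> 1"
    if "F \<in> \<F>" for F
  proof -
    have "(\<Sum>u\<in>X. \<Sum>v\<in>X. \<Sum>P \<in> {P \<in> induced_paths G u v. set P \<inter> F \<noteq> {}}. \<gamma>' u v P)
      \<le> (\<Sum>u\<in>X. \<Sum>v\<in>X. \<Sum>P \<in> {P \<in> induced_paths G u v. set P \<inter> F \<noteq> {}}. \<gamma> u v P)"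
      using \<gamma>' by (intro sum_mono) auto
    also have "\<dots> \<le> 1" using feas that by (simp add: lp_feasible_def)
    finally show ?thesis .
  qed
  then have feas': "lp_feasible G \<F> X \<rho> \<eta>' \<gamma>'"
    using feas \<gamma>'(1) tight by (auto simp: lp_feasible_def \<eta>'_def)
  have "(\<Sum>u\<in>X. \<Sum>v\<in>X. \<eta>' u v) \<le> (\<Sum>u\<in>X. \<Sum>v\<in>X. \<eta> u v)"
    by (intro sum_mono) (simp add: \<eta>'_def)
  then have "f \<le> lp_objective X \<rho> \<eta>'"
    using obj by (simp add: lp_objective_def)
  then have "lp_objective X \<rho> \<eta>' = f"
    using opt feas' by (force simp: lp_optimum_def)
  with feas' tight that show thesis by blast
qed

lemma sum_triples:
  assumes "finite X" "\<And>u. u \<in> X \<Longrightarrow> finite (B u)" "\<And>u v. u \<in> X \<Longrightarrow> v \<in> B u \<Longrightarrow> finite (C u v)"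
  shows "sum m (SIGMA u:X. SIGMA v:B u. C u v) = (\<Sum>u\<in>X. \<Sum>v\<in>B u. \<Sum>P\<in>C u v. m (u, v, P))"
proof -
  have "sum m (SIGMA u:X. SIGMA v:B u. C u v)
    = (\<Sum>u\<in>X. sum (\<lambda>y. m (u, y)) (SIGMA v:B u. C u v))"
    using assms by (subst sum.Sigma) (auto simp: case_prod_unfold)
  also have "\<dots> = (\<Sum>u\<in>X. \<Sum>v\<in>B u. \<Sum>P\<in>C u v. m (u, v, P))"
    using assms by (intro sum.cong refl, subst sum.Sigma) (auto simp: case_prod_unfold)
  finally show ?thesis .
qed

section \<open>Numerical estimates for the number of samples\<close>

text \<open>Union bound over at most \<open>n\<close> members. With \<open>r = l / f\<close> the
  factors are at most 2 to the powers \<open>r / 7\<close>, \<open>- 3 r / 5\<close> and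
  \<open>r / 5\<close>; the total exponent \<open>- 9 r / 35\<close> is below -1 since
  \<open>r \<ge> 7\<close>.\<close>

lemma sampling_bound_hits:
  fixes f :: real and l n :: nat
  assumes "f > 0" "n \<ge> 1" "real l \<ge> 7 * (f * log 2 (real n))" "real l \<ge> 7 * f"
  shows "real n * (2 powr (- (3 * real l / (5 * f))) * (1 + 1 / (10 * f)) ^ l) < 1 / 2"
proof -
  define r where "r = real l / f"
  have r: "7 \<le> r" "log 2 (real n) \<le> r / 7"
    using assms by (auto simp: r_def field_simps)
  have "(1 + 1 / (10 * f)) ^ l \<le> (2 powr (2 * (1 / (10 * f)))) ^ l"
    using assms by (intro power_mono one_plus_le_two_powr) auto
  also have "\<dots> = 2 powr (r / 5)"
    by (simp add: r_def powr_power mult.commute)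
  finally have 1: "(1 + 1 / (10 * f)) ^ l \<le> 2 powr (r / 5)" .
  have "real n = 2 powr log 2 (real n)" using assms by simp
  also have "\<dots> \<le> 2 powr (r / 7)" using r by (intro powr_mono) auto
  finally have 2: "real n \<le> 2 powr (r / 7)" .
  have "real n * (2 powr (- (3 * real l / (5 * f))) * (1 + 1 / (10 * f)) ^ l)
    \<le> 2 powr (r / 7) * (2 powr (- (3 / 5 * r)) * 2 powr (r / 5))"
    using 1 2 assms by (intro mult_mono) (auto simp: r_def)
  also have "\<dots> = 2 powr (r / 7 - 3 / 5 * r + r / 5)"
    by (simp flip: powr_add)
  also have "\<dots> < 2 powr (- 1)"
    using r by (intro powr_less_mono) auto
  finally show ?thesis by (simp add: powr_minus)
qed

text \<open>Union bound over the lists of members and the subsets of \<open>X\<close>, each missed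
  by one sample with probability at most 23/30. Since \<open>(23 / 30) ^ 7 \<le> 1 / 2\<close>, the
  failure probability halves every 7 samples; the summand 2 in the bound on \<open>l\<close> leaves
  the factor 1/4.\<close>

lemma sampling_bound_cuts:
  fixes f :: real and l n N :: nat
  assumes "f > 0" "n \<ge> 1" "real l \<ge> 7 * (f * log 2 (real n) + real N + 2)"
  shows "real (n ^ nat \<lfloor>f\<rfloor>) * 2 ^ N * (23 / 30) ^ l \<le> 1 / 4"
proof -
  have "real (n ^ nat \<lfloor>f\<rfloor>) = real n powr real (nat \<lfloor>f\<rfloor>)"
    using assms by (subst powr_realpow) auto
  also have "\<dots> \<le> real n powr f"
    using assms by (intro powr_mono) auto
  also have "\<dots> = 2 powr (f * log 2 (real n))"
    using assms by (simp add: powr_def log_def)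
  finally have 1: "real (n ^ nat \<lfloor>f\<rfloor>) \<le> 2 powr (f * log 2 (real n))" .
  have "(23 / 30 :: real) = ((23 / 30) powr real 7) powr (1 / 7)"
    by (subst powr_powr) simp
  also have "\<dots> = ((23 / 30) ^ 7) powr (1 / 7)"
    by (subst powr_realpow) auto
  also have "\<dots> \<le> (1 / 2) powr (1 / 7)"
    by (intro powr_mono2) (auto simp: power_divide)
  also have "\<dots> = 2 powr (- 1 / 7)"
    by (simp add: powr_divide powr_minus_divide)
  finally have "(23 / 30 :: real) ^ l \<le> (2 powr (- 1 / 7)) ^ l"
    by (intro power_mono) auto
  also have "\<dots> = 2 powr (- real l / 7)"
    by (simp add: powr_power)
  finally have 2: "(23 / 30 :: real) ^ l \<le> 2 powr (- real l / 7)" .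
  have "real (n ^ nat \<lfloor>f\<rfloor>) * 2 ^ N * (23 / 30) ^ l
    \<le> 2 powr (f * log 2 (real n)) * 2 powr real N * 2 powr (- real l / 7)"
    using 1 2 by (intro mult_mono) (auto simp: powr_realpow)
  also have "\<dots> = 2 powr (f * log 2 (real n) + real N - real l / 7)"
    by (simp flip: powr_add)
  also have "\<dots> \<le> 2 powr (- 2)"
    using assms by (intro powr_mono) auto
  finally show ?thesis by (simp add: powr_minus)
qed

lemma sum_UN_le:
  fixes m :: "'w \<Rightarrow> real"
  assumes "finite I" "\<And>i. i \<in> I \<Longrightarrow> finite (A i)" "\<And>i x. i \<in> I \<Longrightarrow> x \<in> A i \<Longrightarrow> 0 \<le> m x"
  shows "sum m (\<Union>i\<in>I. A i) \<le> (\<Sum>i\<in>I. sum m (A i))"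
  using assms
proof (induction I rule: finite_induct)
  case (insert i I)
  have "sum m (A i \<union> (\<Union>i\<in>I. A i)) = sum m (A i) + sum m (\<Union>i\<in>I. A i) - sum m (A i \<inter> (\<Union>i\<in>I. A i))"
    using insert by (intro sum_Un) auto
  also have "\<dots> \<le> sum m (A i) + sum m (\<Union>i\<in>I. A i)"
    using insert.prems by (auto intro!: sum_nonneg)
  finally show ?case using insert by fastforce
qed simp

lemma vwalk_induce_subgraph:
  assumes "vwalk p G" "set p \<subseteq> U"
  shows "vwalk p (G \<restriction> U)"
  using assms
proof (induction p rule: vwalk_induct)
  case (Cons u v es)
  then have "(u, v) \<in> arcs_ends (G \<restriction> U)"
    by (auto simp: arcs_ends_def arc_to_ends_def)
  with Cons show ?case by (auto intro!: vwalk_consI)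
qed simp

section \<open>From an optimal solution to path weights and a good sample\<close>

context layered_graph
begin

lemma finite_induced_paths: "finite (induced_paths G u v)"
  by (rule finite_subset[OF _ vpaths_finite]) (auto simp: induced_paths_def)

lemma layer_centers_subset: "layer_centers G Ls \<subseteq> verts G"
  by (auto simp: layer_centers_def)

lemma finite_layered_family: "finite (layered_family G Ls)"
  using finite_subset[OF layer_centers_subset] by (simp add: layered_family_def)

lemma card_layered_family_le: "card (layered_family G Ls) \<le> card (verts G)"
  unfolding layered_family_def
  by (meson card_image_le card_mono finite_subset finite_verts layer_centers_subset order_trans)

lemma center_in_own_descendants: "c \<in> layer_centers G Ls \<Longrightarrow> c \<in> descendants D c"
  using layer_centers_subset by (auto simp: descendants_def)

definition hits :: "'a set \<Rightarrow> 'a \<times> 'a \<times> 'a list \<Rightarrow> bool" where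
  "hits F w \<longleftrightarrow> set (snd (snd w)) \<inter> F \<noteq> {}"

definition crosses :: "'a set \<Rightarrow> 'a \<times> 'a \<times> 'a list \<Rightarrow> bool" where
  "crosses A w \<longleftrightarrow> (fst w \<in> A) \<noteq> (fst (snd w) \<in> A)"

text \<open>The sample space: keeping the endpoints with the path turns the three-index family
  \<open>\<gamma>\<close> into one weight function.\<close>

definition triples :: "'a set \<Rightarrow> ('a \<times> 'a \<times> 'a list) set" where
  "triples X = (SIGMA u:X. SIGMA v:X. induced_paths G u v)"

lemma finite_triples: "finite X \<Longrightarrow> finite (triples X)"
  unfolding triples_def using finite_induced_paths by blast

text \<open>
  With a tight solution, \<open>E\<close> is the sum of all \<open>\<eta>\<close>, and the objective value gives
  \<open>card X * (\<Sum>u\<in>X. \<rho> u) = 10 * (f + E)\<close>.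
\<close>

lemma lp_optimum_path_weights:
  assumes X: "X \<subseteq> layer_centers G Ls" and opt: "lp_optimum G (layered_family G Ls) X f"
  obtains m :: "'a \<times> 'a \<times> 'a list \<Rightarrow> real" and E where
    "\<And>w. w \<in> triples X \<Longrightarrow> 0 \<le> m w" "0 \<le> E"
    "sum m (triples X) = 10 * f + 9 * E" "sum m (triples X) \<le> real (card X)"
    "\<And>F. F \<in> layered_family G Ls \<Longrightarrow> (\<Sum>w | w \<in> triples X \<and> hits F w. m w) \<le> 1"
    "\<And>A. A \<subseteq> X \<Longrightarrow> card X \<le> 3 * card A \<Longrightarrow> 3 * card A \<le> 2 * card X \<Longrightarrow>
      (\<Sum>w | w \<in> triples X \<and> crosses A w. m w) \<ge> (10 * f + 7 * E) / 3"
proof -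
  obtain \<rho> \<eta> \<gamma> where feas: "lp_feasible G (layered_family G Ls) X \<rho> \<eta> \<gamma>" 
    and obj: "lp_objective X \<rho> \<eta> = f"
    and tight: "\<And>u v. u \<in> X \<Longrightarrow> v \<in> X \<Longrightarrow> (\<Sum>P\<in>induced_paths G u v. \<gamma> u v P) = \<rho> u - \<eta> u v"
    using lp_optimum_tight[OF opt] by blast
  have finX: "finite X"
    using X layer_centers_subset finite_verts by (meson finite_subset)
  define m where "m w = (case w of (u, v, P) \<Rightarrow> \<gamma> u v P)" for w
  define E where "E = (\<Sum>u\<in>X. \<Sum>v\<in>X. \<eta> u v)"
  let ?r = "\<Sum>u\<in>X. \<rho> u"
  have nonneg: "0 \<le> m w" if "w \<in> triples X" for w
    using feas that by (auto simp: m_def triples_def lp_feasible_def)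
  have \<rho>0: "0 \<le> \<rho> u" and \<eta>0: "v \<in> X \<Longrightarrow> 0 \<le> \<eta> u v" if "u \<in> X" for u v
    using feas that by (auto simp: lp_feasible_def)
  have E0: "0 \<le> E" using \<eta>0 by (auto simp: E_def intro!: sum_nonneg)
  have r: "real (card X) * ?r = 10 * f + 10 * E"
    using obj by (simp add: lp_objective_def E_def field_simps)
  have "sum m (triples X) = (\<Sum>u\<in>X. \<Sum>v\<in>X. \<rho> u - \<eta> u v)"
    unfolding triples_def using finX finite_induced_paths tight
    by (subst sum_triples) (auto simp: m_def)
  also have "\<dots> = real (card X) * ?r - E"
    by (simp add: sum_subtractf E_def sum_distrib_left)
  finally have total: "sum m (triples X) = 10 * f + 9 * E" using r by simp
  have hit: "(\<Sum>w | w \<in> triples X \<and> hits F w. m w) \<le> 1" if "F \<in> layered_family G Ls" for F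
  proof -
    have "{w \<in> triples X. hits F w}
      = (SIGMA u:X. SIGMA v:X. {P \<in> induced_paths G u v. set P \<inter> F \<noteq> {}})"
      by (auto simp: triples_def hits_def)
    then have "(\<Sum>w | w \<in> triples X \<and> hits F w. m w)
      = (\<Sum>u\<in>X. \<Sum>v\<in>X. \<Sum>P \<in> {P \<in> induced_paths G u v. set P \<inter> F \<noteq> {}}. \<gamma> u v P)"
      using finX finite_induced_paths by (simp add: sum_triples m_def)
    also have "\<dots> \<le> 1" using feas that by (simp add: lp_feasible_def)
    finally show ?thesis .
  qed
  have "sum m (triples X) = (\<Sum>u\<in>X. \<Sum>v\<in>X. \<Sum>P\<in>induced_paths G u v. \<gamma> u v P)"
    unfolding triples_def using finX finite_induced_paths by (simp add: sum_triples m_def)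
  \<comment> \<open>All paths starting at \<open>u\<close> hit the member with center
    \<open>u\<close>, whose constraint bounds their mass by 1.\<close>
  also have "\<dots> \<le> (\<Sum>u\<in>X. 1)"
  proof (rule sum_mono)
    fix u assume u: "u \<in> X"
    let ?F = "descendants D u"
    have "(\<Sum>v\<in>X. \<Sum>P\<in>induced_paths G u v. \<gamma> u v P) = sum m (SIGMA x:{u}. SIGMA v:X. induced_paths G x v)"
      using finX finite_induced_paths by (simp add: sum_triples m_def)
    also have "\<dots> \<le> (\<Sum>w | w \<in> triples X \<and> hits ?F w. m w)"
    proof (rule sum_mono2)
      show "finite {w \<in> triples X. hits ?F w}" using finite_triples[OF finX] by simp
      show "(SIGMA x:{u}. SIGMA v:X. induced_paths G x v) \<subseteq> {w \<in> triples X. hits ?F w}"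
      proof
        fix w assume w: "w \<in> (SIGMA x:{u}. SIGMA v:X. induced_paths G x v)"
        then have "u \<in> set (snd (snd w))"
          using hd_in_set[of "snd (snd w)"] by (auto simp: induced_paths_def vpath_def vwalk_def)
        then have "hits ?F w"
          using u X center_in_own_descendants[of u] by (auto simp: hits_def)
        with w u show "w \<in> {w \<in> triples X. hits ?F w}" by (auto simp: triples_def)
      qed
    qed (use nonneg in auto)
    also have "\<dots> \<le> 1"
      using u X by (intro hit) (auto simp: layered_family_def)
    finally show "(\<Sum>v\<in>X. \<Sum>P\<in>induced_paths G u v. \<gamma> u v P) \<le> 1" .
  qed
  finally have le_card: "sum m (triples X) \<le> real (card X)" by simp
  have "(\<Sum>w | w \<in> triples X \<and> crosses A w. m w) \<ge> (10 * f + 7 * E) / 3"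
    if A: "A \<subseteq> X" "card X \<le> 3 * card A" "3 * card A \<le> 2 * card X" for A
  proof -
    \<comment> \<open>\<open>B u\<close> is the side of the cut opposite to \<open>u\<close>; both
      \<open>A\<close> and \<open>X - A\<close> have at least a third of \<open>X\<close>.\<close>
    define B where "B u = {v \<in> X. (u \<in> A) \<noteq> (v \<in> A)}" for u
    have B: "B u \<subseteq> X" "finite (B u)" for u using finX by (auto simp: B_def)
    have cardB: "real (card X) / 3 \<le> real (card (B u))" for u
    proof -
      have "B u = (if u \<in> A then X - A else A)" using A(1) by (auto simp: B_def)
      then show ?thesis
        using A finX card_Diff_subset[of A X] finite_subset[OF A(1)] card_mono[OF finX A(1)]
        by (auto simp: of_nat_diff)
    qed
    have "{w \<in> triples X. crosses A w} = (SIGMA u:X. SIGMA v:B u. induced_paths G u v)"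
      by (auto simp: triples_def crosses_def B_def)
    then have "(\<Sum>w | w \<in> triples X \<and> crosses A w. m w)
      = (\<Sum>u\<in>X. \<Sum>v\<in>B u. \<Sum>P\<in>induced_paths G u v. \<gamma> u v P)"
      using finX B finite_induced_paths by (simp add: sum_triples m_def)
    also have "\<dots> = (\<Sum>u\<in>X. \<Sum>v\<in>B u. \<rho> u - \<eta> u v)"
      using B tight by (intro sum.cong refl) blast
    also have "\<dots> = (\<Sum>u\<in>X. real (card (B u)) * \<rho> u) - (\<Sum>u\<in>X. \<Sum>v\<in>B u. \<eta> u v)"
      by (simp add: sum_subtractf)
    \<comment> \<open>Each \<open>\<rho> u\<close> is counted at least \<open>card X / 3\<close>
      times, while the subtracted part of \<open>\<eta>\<close> is at most \<open>E\<close>.\<close>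
    also have "\<dots> \<ge> (\<Sum>u\<in>X. real (card X) / 3 * \<rho> u) - E"
      unfolding E_def using cardB \<rho>0 \<eta>0 B finX
      by (intro diff_mono sum_mono mult_right_mono sum_mono2) auto
    also have "(\<Sum>u\<in>X. real (card X) / 3 * \<rho> u) = real (card X) * ?r / 3"
      by (simp add: sum_distrib_left sum_divide_distrib)
    also have "real (card X) * ?r / 3 - E = (10 * f + 7 * E) / 3"
      using r by simp
    finally show ?thesis .
  qed
  with that nonneg E0 total le_card hit show thesis by blast
qed

text \<open>The mass \<open>10 * f + 9 * E\<close> is at most \<open>card X\<close>. Later this
  gives \<open>f < 1\<close> when \<open>X\<close> has at most one element.\<close>

lemma lp_optimum_le_card:
  assumes "X \<subseteq> layer_centers G Ls" "lp_optimum G (layered_family G Ls) X f"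
  shows "10 * f \<le> real (card X)"
  using lp_optimum_path_weights[OF assms] by force

text \<open>One nonnegative sum estimates all bad events together. Its bound is below 1/2 + 1/4, so
  some list makes every single term less than 1, which rules out each event.\<close>

lemma exists_sample:
  assumes X: "X \<subseteq> layer_centers G Ls" and opt: "lp_optimum G (layered_family G Ls) X f" and "f > 0"
    and l: "real l \<ge> 7 * (f * log 2 (real (card (verts G))) + real (card X) + 2)"
  obtains ws where "set ws \<subseteq> triples X"
    "\<And>F. F \<in> layered_family G Ls \<Longrightarrow> real (length (filter (hits F) ws)) \<le> 3 * real l / (5 * f)"
    "\<And>\<A> A. \<A> \<subseteq> layered_family G Ls \<Longrightarrow> real (card \<A>) \<le> f \<Longrightarrow> A \<subseteq> X \<Longrightarrow>
      card X \<le> 3 * card A \<Longrightarrow> 3 * card A \<le> 2 * card X \<Longrightarrow> \<exists>w\<in>set ws. crosses A w \<and> \<not> hits (\<Union>\<A>) w"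
proof -
  let ?W = "triples X" and ?Fam = "layered_family G Ls"
  obtain m :: "'a \<times> 'a \<times> 'a list \<Rightarrow> real" and E where
    m0: "\<And>w. w \<in> ?W \<Longrightarrow> 0 \<le> m w" and E0: "0 \<le> E"
    and total: "sum m ?W = 10 * f + 9 * E" and le_card: "sum m ?W \<le> real (card X)"
    and hit: "\<And>F. F \<in> ?Fam \<Longrightarrow> (\<Sum>w | w \<in> ?W \<and> hits F w. m w) \<le> 1"
    and cross: "\<And>A. A \<subseteq> X \<Longrightarrow> card X \<le> 3 * card A \<Longrightarrow> 3 * card A \<le> 2 * card X \<Longrightarrow>
      (\<Sum>w | w \<in> ?W \<and> crosses A w. m w) \<ge> (10 * f + 7 * E) / 3"
    using lp_optimum_path_weights[OF X opt] by blast
  define \<Gamma> where "\<Gamma> = sum m ?W"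
  have \<Gamma>: "\<Gamma> > 0" "10 * f \<le> \<Gamma>" "\<Gamma> \<le> real (card X)" "\<Gamma> = 10 * f + 9 * E"
    using total le_card E0 \<open>f > 0\<close> by (auto simp: \<Gamma>_def)
  have finX: "finite X"
    using X layer_centers_subset finite_verts by (meson finite_subset)
  have finW: "finite ?W" by (rule finite_triples[OF finX])
  have "X \<noteq> {}" using \<Gamma> by auto
  then have n: "card (verts G) \<ge> 1"
    using X layer_centers_subset finite_verts by (metis One_nat_def Suc_leI card_gt_0_iff subset_empty subset_trans)
  define t where "t = nat \<lfloor>f\<rfloor>"
  define \<L> where "\<L> = {xs. set xs \<subseteq> ?Fam \<and> length xs = t}"
  define \<C> where "\<C> = {A. A \<subseteq> X \<and> card X \<le> 3 * card A \<and> 3 * card A \<le> 2 * card X}"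
  have fin: "finite \<L>" "finite \<C>"
    using finite_lists_length_eq[OF finite_layered_family] finX by (auto simp: \<L>_def \<C>_def)
  define I where "I = ?Fam <+> (\<L> \<times> \<C>)"
  have finI: "finite I" using fin finite_layered_family by (simp add: I_def)
  define p where "p w = m w / \<Gamma>" for w
  \<comment> \<open>Pessimistic estimators of the bad events: \<open>Inl F\<close> for too many paths hitting \<open>F\<close>, and
    \<open>Inr (xs, A)\<close> for no path crossing \<open>A\<close> outside the members listed in \<open>xs\<close>. Lists of length
    exactly \<open>t\<close> allow repetitions and so represent all nonempty subfamilies of size at most \<open>t\<close>.\<close>
  define a where "a i = (case i of Inl F \<Rightarrow> 2 powr (- (3 * real l / (5 * f))) | Inr _ \<Rightarrow> (1 :: real))"
    for i :: "'a set + ('a set list \<times> 'a set)"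
  define g where "g i w = (case i of Inl F \<Rightarrow> if hits F w then 2 else 1
      | Inr (xs, A) \<Rightarrow> if crosses A w \<and> \<not> hits (\<Union>(set xs)) w then 0 else (1 :: real))"
    for i :: "'a set + ('a set list \<times> 'a set)" and w
  \<comment> \<open>A hit doubles the factor and has probability at most
    \<open>1 / (10 * f)\<close>; the constant 23/30 is 1 - 7/30.\<close>
  define c where "c i = (case i of Inl F \<Rightarrow> 1 + 1 / (10 * f) | Inr _ \<Rightarrow> (23 / 30 :: real))"
    for i :: "'a set + ('a set list \<times> 'a set)"
  have p: "0 \<le> p w" if "w \<in> ?W" for w using m0 that \<Gamma> by (simp add: p_def)
  have sum_p: "sum p ?W = 1" using \<Gamma> by (simp add: p_def \<Gamma>_def flip: sum_divide_distrib)
  have avg: "(\<Sum>w\<in>?W. p w * g i w) \<le> c i" if "i \<in> I" for i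
  proof (cases i)
    case (Inl F)
    then have F: "F \<in> ?Fam" using that by (auto simp: I_def)
    have "(\<Sum>w\<in>?W. p w * g i w) = (\<Sum>w\<in>?W. p w + (if hits F w then p w else 0))"
      by (intro sum.cong) (auto simp: g_def Inl)
    also have "\<dots> = 1 + (\<Sum>w | w \<in> ?W \<and> hits F w. p w)"
      using finW sum_p by (simp add: sum.distrib sum.inter_filter)
    also have "\<dots> = 1 + (\<Sum>w | w \<in> ?W \<and> hits F w. m w) / \<Gamma>"
      by (simp add: p_def sum_divide_distrib)
    also have "\<dots> \<le> 1 + 1 / (10 * f)"
      using hit[OF F] \<Gamma> \<open>f > 0\<close> m0 by (intro add_left_mono frac_le) auto
    finally show ?thesis by (simp add: c_def Inl)
  next
    case (Inr y)
    obtain xs A where y: "y = (xs, A)" by force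
    have xs: "set xs \<subseteq> ?Fam" "length xs = t" and A: "A \<subseteq> X" "card X \<le> 3 * card A" "3 * card A \<le> 2 * card X"
      using that by (auto simp: I_def Inr y \<L>_def \<C>_def)
    let ?K = "{w \<in> ?W. crosses A w \<and> \<not> hits (\<Union>(set xs)) w}"
    \<comment> \<open>From the crossing mass subtract at most 1 for each of at most \<open>f\<close>
      members. The remaining \<open>(7 * f + 7 * E) / 3\<close> is at least 7/30 of the total
      \<open>10 * f + 9 * E\<close>.\<close>
    have "(10 * f + 7 * E) / 3 \<le> (\<Sum>w | w \<in> ?W \<and> crosses A w. m w)" by (rule cross[OF A])
    also have "\<dots> \<le> (\<Sum>w \<in> ?K \<union> (\<Union>F\<in>set xs. {w \<in> ?W. hits F w}). m w)"
      using finW m0 by (intro sum_mono2) (auto simp: hits_def)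
    also have "\<dots> \<le> sum m ?K + sum m (\<Union>F\<in>set xs. {w \<in> ?W. hits F w})"
      using finW m0 by (subst sum_Un) (auto intro!: sum_nonneg)
    also have "sum m (\<Union>F\<in>set xs. {w \<in> ?W. hits F w}) \<le> (\<Sum>F\<in>set xs. sum m {w \<in> ?W. hits F w})"
      using finW m0 by (intro sum_UN_le) auto
    also have "\<dots> \<le> (\<Sum>F\<in>set xs. 1)"
      using hit xs(1) by (intro sum_mono) auto
    also have "\<dots> \<le> real t"
      using card_length[of xs] xs(2) by simp
    also have "\<dots> \<le> f" using \<open>f > 0\<close> by (simp add: t_def)
    finally have K: "(7 * f + 7 * E) / 3 \<le> sum m ?K" by simp
    have "(\<Sum>w\<in>?W. p w * g i w) = (\<Sum>w\<in>?W. p w - (if crosses A w \<and> \<not> hits (\<Union>(set xs)) w then p w else 0))"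
      by (intro sum.cong) (auto simp: g_def Inr y)
    also have "\<dots> = 1 - sum p ?K"
      using finW sum_p by (simp add: sum_subtractf sum.inter_filter)
    also have "\<dots> = 1 - sum m ?K / \<Gamma>"
      by (simp add: p_def sum_divide_distrib)
    also have "\<dots> \<le> 1 - 7 / 30"
      using K \<Gamma>(1,4) E0 by (simp add: field_simps)
    finally show ?thesis by (simp add: c_def Inr)
  qed
  obtain ws where ws: "length ws = l" "set ws \<subseteq> ?W"
    "(\<Sum>i\<in>I. a i * (\<Prod>w\<leftarrow>ws. g i w)) \<le> (\<Sum>i\<in>I. a i * c i ^ l)"
    using exists_list_prod_le_average[where a = a and l = l, OF finW finI p sum_p _ _ avg]
    by (force simp: a_def g_def split: sum.splits)
  have "(\<Sum>i\<in>I. a i * c i ^ l)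
    = real (card ?Fam) * (2 powr (- (3 * real l / (5 * f))) * (1 + 1 / (10 * f)) ^ l)
      + real (card \<L> * card \<C>) * (23 / 30) ^ l"
    unfolding I_def using fin finite_layered_family
    by (subst sum.Plus) (auto simp: a_def c_def card_cartesian_product)
  also have "\<dots> \<le> real (card (verts G)) * (2 powr (- (3 * real l / (5 * f))) * (1 + 1 / (10 * f)) ^ l)
      + real (card (verts G) ^ t) * 2 ^ card X * (23 / 30) ^ l"
  proof (intro add_mono mult_right_mono)
    show "real (card ?Fam) \<le> real (card (verts G))" using card_layered_family_le by simp
    have "card \<L> \<le> card (verts G) ^ t"
      using card_lists_length_eq[OF finite_layered_family, of t] card_layered_family_le
      by (simp add: \<L>_def power_mono)
    moreover have "card \<C> \<le> 2 ^ card X"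
      using card_mono[of "Pow X" \<C>] finX by (auto simp: \<C>_def card_Pow)
    ultimately have "card \<L> * card \<C> \<le> card (verts G) ^ t * 2 ^ card X" by (rule mult_le_mono)
    then show "real (card \<L> * card \<C>) \<le> real (card (verts G) ^ t) * 2 ^ card X"
      by (metis of_nat_le_iff of_nat_mult of_nat_numeral of_nat_power)
  qed (use \<open>f > 0\<close> in auto)
  also have "\<dots> < 1 / 2 + 1 / 4"
  proof (rule add_less_le_mono)
    have "0 \<le> f * log 2 (real (card (verts G)))"
      using n \<open>f > 0\<close> by simp
    \<comment> \<open>The first bound comes from \<open>10 * f \<le> card X\<close>.\<close>
    then have "7 * f \<le> real l \<and> 7 * (f * log 2 (real (card (verts G)))) \<le> real l"
      using l \<Gamma> \<open>f > 0\<close> by argo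
    then show "real (card (verts G)) * (2 powr (- (3 * real l / (5 * f))) * (1 + 1 / (10 * f)) ^ l) < 1 / 2"
      using sampling_bound_hits \<open>f > 0\<close> n by blast
    show "real (card (verts G) ^ t) * 2 ^ card X * (23 / 30) ^ l \<le> 1 / 4"
      unfolding t_def using sampling_bound_cuts \<open>f > 0\<close> n l by blast
  qed
  finally have "(\<Sum>i\<in>I. a i * (\<Prod>w\<leftarrow>ws. g i w)) < 1" using ws(3) by simp
  moreover have g0: "0 \<le> a i * (\<Prod>w\<leftarrow>ws. g i w)" for i
    by (intro mult_nonneg_nonneg prod_list_nonneg) (auto simp: a_def g_def split: sum.splits)
  ultimately have small: "a i * (\<Prod>w\<leftarrow>ws. g i w) < 1" if "i \<in> I" for i
    using member_le_sum[OF that, of "\<lambda>i. a i * (\<Prod>w\<leftarrow>ws. g i w)"] finI by fastforce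
  show thesis
  proof (rule that[OF ws(2)])
    fix F assume "F \<in> ?Fam"
    then have "2 powr (- (3 * real l / (5 * f))) * (\<Prod>w\<leftarrow>ws. if hits F w then 2 else 1) < (1 :: real)"
      using small[of "Inl F"] by (simp add: I_def a_def g_def InlI)
    moreover have "(\<Prod>w\<leftarrow>ws. if hits F w then 2 else 1) = (2 powr real (length (filter (hits F) ws)) :: real)"
      by (induction ws) (auto simp: powr_add)
    ultimately have "2 powr (real (length (filter (hits F) ws)) - 3 * real l / (5 * f)) < (2 :: real) powr 0"
      by (simp flip: powr_add)
    then have "real (length (filter (hits F) ws)) - 3 * real l / (5 * f) < 0"
      by (subst (asm) powr_less_cancel_iff) simp_all
    then show "real (length (filter (hits F) ws)) \<le> 3 * real l / (5 * f)"
      by simp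
  next
    fix \<A> A assume \<A>: "\<A> \<subseteq> ?Fam" "real (card \<A>) \<le> f"
      and A: "A \<subseteq> X" "card X \<le> 3 * card A" "3 * card A \<le> 2 * card X"
    \<comment> \<open>\<open>F0\<close> pads a list to length \<open>t\<close>, also for empty
      \<open>\<A>\<close>; avoiding an additional member only strengthens the conclusion.\<close>
    obtain F0 where "F0 \<in> ?Fam"
      using \<open>X \<noteq> {}\<close> X by (auto simp: layered_family_def)
    have fin\<A>: "finite \<A>" using \<A>(1) finite_layered_family finite_subset by blast
    then obtain ys where ys: "set ys = \<A>" "length ys = card \<A>"
      by (metis finite_distinct_list distinct_card)
    have "card \<A> \<le> t" using \<A>(2) by (simp add: t_def le_nat_floor)
    let ?xs = "ys @ replicate (t - card \<A>) F0"
    have "?xs \<in> \<L>"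
      using ys \<A>(1) \<open>F0 \<in> ?Fam\<close> \<open>card \<A> \<le> t\<close> by (auto simp: \<L>_def)
    then have "(\<Prod>w\<leftarrow>ws. g (Inr (?xs, A)) w) < 1"
      using small[of "Inr (?xs, A)"] A by (simp add: I_def a_def \<C>_def InrI)
    \<comment> \<open>All factors are 0 or 1, so a product below 1 has a zero factor, and this comes
      from a sample as wanted.\<close>
    moreover have "\<exists>w\<in>set vs. crosses A w \<and> \<not> hits (\<Union>(set ?xs)) w"
      if "(\<Prod>w\<leftarrow>vs. g (Inr (?xs, A)) w) < 1" for vs
      using that by (induction vs) (auto simp: g_def simp del: set_append split: if_splits)
    ultimately have "\<exists>w\<in>set ws. crosses A w \<and> \<not> hits (\<Union>(set ?xs)) w" by blast
    then show "\<exists>w\<in>set ws. crosses A w \<and> \<not> hits (\<Union>\<A>) w"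
      using ys by (auto simp: hits_def)
  qed
qed

end

section \<open>The induced subgraph and its two properties\<close>

theorem theorem7p1:
  fixes G :: "('a, 'b) pre_digraph" and Ls :: "'a set list" and X :: "'a set"
    and k l :: nat and f :: real
  assumes "graph G"
    and "ordered_partition Ls (verts G)"
    and "k > 0"
    and "thickness G Ls \<le> k"
    and "X \<subseteq> layer_centers G Ls"
    and "lp_optimum G (layered_family G Ls) X f"
    and "f > 0"
    and "l > 0"
    and "real l \<ge> 7 * (f * log 2 (real (card (verts G))) + real (card X) + 2)"
  shows "\<exists>H. induced_subgraph H G \<and> X \<subseteq> verts H \<and>
           (\<forall>S. balanced_separator H X (1/2) S \<longrightarrow> real (cov (layered_family G Ls) S) \<ge> f) \<and>
           (\<forall>F \<in> layered_family G Ls.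
              real (card (F \<inter> verts H)) \<le> 1 + (3 * real l) / (5 * f) * (2 * real k - 1))"
proof -
  interpret layered_graph G Ls
    using assms(1,2) by (simp add: layered_graph_def layered_graph_axioms_def)
  let ?Fam = "layered_family G Ls"
  have XG: "X \<subseteq> verts G" using assms(5) layer_centers_subset by blast
  then have finX: "finite X" using finite_verts finite_subset by blast
  obtain ws where ws: "set ws \<subseteq> triples X"
    and few: "\<And>F. F \<in> ?Fam \<Longrightarrow> real (length (filter (hits F) ws)) \<le> 3 * real l / (5 * f)"
    and cut: "\<And>\<A> A. \<A> \<subseteq> ?Fam \<Longrightarrow> real (card \<A>) \<le> f \<Longrightarrow> A \<subseteq> X \<Longrightarrow>
      card X \<le> 3 * card A \<Longrightarrow> 3 * card A \<le> 2 * card X \<Longrightarrow> \<exists>w\<in>set ws. crosses A w \<and> \<not> hits (\<Union>\<A>) w"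
    using exists_sample[OF assms(5,6,7,9)] by blast
  define good where "good w Q \<longleftrightarrow> vwalk Q G \<and> hd Q = fst w \<and> last Q = fst (snd w) \<and>
    (\<forall>F\<in>?Fam. (set Q \<inter> F \<noteq> {} \<longrightarrow> hits F w) \<and> card (F \<inter> set Q) \<le> 2 * thickness G Ls - 1)" for w Q
  have "\<exists>Q. good w Q" if "w \<in> set ws" for w
  proof -
    have P: "vwalk (snd (snd w)) G" "hd (snd (snd w)) = fst w" "last (snd (snd w)) = fst (snd w)"
      using that ws by (auto simp: triples_def induced_paths_def vpath_def)
    obtain Q where "vwalk Q G" "hd Q = fst w" "last Q = fst (snd w)"
      "\<And>F. F \<in> ?Fam \<Longrightarrow> set Q \<inter> F \<noteq> {} \<Longrightarrow> hits F w"
      "\<And>F. F \<in> ?Fam \<Longrightarrow> card (F \<inter> set Q) \<le> 2 * thickness G Ls - 1"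
      by (rule reroute[OF P(1)]) (auto simp: P(2,3) hits_def)
    then show ?thesis by (intro exI[of _ Q]) (simp add: good_def)
  qed
  then obtain Q where "\<And>w. w \<in> set ws \<Longrightarrow> good w (Q w)" by metis
  then have Q: "\<And>w. w \<in> set ws \<Longrightarrow> vwalk (Q w) G"
    "\<And>w. w \<in> set ws \<Longrightarrow> hd (Q w) = fst w" "\<And>w. w \<in> set ws \<Longrightarrow> last (Q w) = fst (snd w)"
    and Qhits: "\<And>w F. w \<in> set ws \<Longrightarrow> F \<in> ?Fam \<Longrightarrow> set (Q w) \<inter> F \<noteq> {} \<Longrightarrow> hits F w"
    and Qcard: "\<And>w F. w \<in> set ws \<Longrightarrow> F \<in> ?Fam \<Longrightarrow> card (F \<inter> set (Q w)) \<le> 2 * thickness G Ls - 1"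
    unfolding good_def by blast+
  define V where "V = X \<union> (\<Union>w\<in>set ws. set (Q w))"
  have "set (Q w) \<subseteq> verts G" if "w \<in> set ws" for w
    using Q(1)[OF that] by (simp add: vwalk_def)
  then have VG: "V \<subseteq> verts G"
    unfolding V_def using XG by blast
  define H where "H = G \<restriction> V"
  have H: "induced_subgraph H G" unfolding H_def using VG by (rule induced_induce)
  have vH: "verts H = V" by (simp add: H_def)
  have "real (card (F \<inter> V)) \<le> 1 + (3 * real l) / (5 * f) * (2 * real k - 1)" if F: "F \<in> ?Fam" for F
  proof -
    obtain c where c: "F = descendants D c" using F by (auto simp: layered_family_def)
    have "F \<inter> X \<subseteq> {c}"
      using center_reachableD assms(5) by (auto simp: c descendants_def)
    then have 1: "card (F \<inter> X) \<le> 1" using card_mono[of "{c}"] by simp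
    let ?hs = "filter (hits F) ws"
    \<comment> \<open>Rerouting adds no new hits, so only samples hitting \<open>F\<close>
      contribute vertices of \<open>F\<close>.\<close>
    have "F \<inter> V \<subseteq> (F \<inter> X) \<union> (\<Union>w\<in>set ?hs. F \<inter> set (Q w))"
      using Qhits[OF _ F] by (auto simp: V_def)
    then have "card (F \<inter> V) \<le> card ((F \<inter> X) \<union> (\<Union>w\<in>set ?hs. F \<inter> set (Q w)))"
      using finX by (intro card_mono) auto
    also have "\<dots> \<le> card (F \<inter> X) + (\<Sum>w\<in>set ?hs. card (F \<inter> set (Q w)))"
      by (rule order_trans[OF card_Un_le add_left_mono[OF card_UN_le]]) simp
    also have "\<dots> \<le> 1 + (\<Sum>w\<in>set ?hs. 2 * k - 1)"
    proof (intro add_mono 1 sum_mono)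
      fix w assume "w \<in> set ?hs"
      then have "card (F \<inter> set (Q w)) \<le> 2 * thickness G Ls - 1" using Qcard F by simp
      then show "card (F \<inter> set (Q w)) \<le> 2 * k - 1" using assms(4) by linarith
    qed
    also have "\<dots> \<le> 1 + length ?hs * (2 * k - 1)"
      using card_length[of ?hs] by simp
    finally have "real (card (F \<inter> V)) \<le> real (1 + length ?hs * (2 * k - 1))"
      by (rule of_nat_mono)
    also have "\<dots> = 1 + real (length ?hs) * (2 * real k - 1)"
      using assms(3) by (simp add: of_nat_diff)
    also have "\<dots> \<le> 1 + (3 * real l) / (5 * f) * (2 * real k - 1)"
      using few[OF F] assms(3) by (intro add_left_mono mult_right_mono) auto
    finally show ?thesis .
  qed
  moreover have "f \<le> real (cov ?Fam S)" if sep: "balanced_separator H X (1/2) S" for S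
  proof (rule ccontr)
    assume "\<not> ?thesis"
    then have less: "real (cov ?Fam S) < f" by simp
    have SV: "S \<subseteq> V" using sep by (simp add: balanced_separator_def vH)
    obtain \<A> where \<A>: "\<A> \<subseteq> ?Fam" "finite \<A>" "card \<A> = cov ?Fam S" "S \<subseteq> \<Union>\<A>"
      using cov_cover SV VG by (metis subset_trans)
    have cardX: "10 * f \<le> real (card X)" by (rule lp_optimum_le_card[OF assms(5,6)])
    define K where "K = H \<restriction> (V - S)"
    have vK: "verts K = V - S" by (simp add: K_def)
    interpret H: wf_digraph H
      unfolding H_def by (rule wellformed_induce_subgraph)
    interpret K: wf_digraph K
      unfolding K_def by (rule H.wellformed_induce_subgraph)
    have small: "2 * card (K.scc_of x \<inter> X) \<le> card X" if "x \<in> X - S" for x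
    proof -
      have "K.scc_of x \<in> verts ` K.sccs"
        using that K.scc_of_in_sccs_verts[of x] by (auto simp: vK V_def K.sccs_verts_conv)
      then show ?thesis
        using sep by (auto simp: balanced_separator_def vH K_def)
    qed
    \<comment> \<open>The label of a vertex is its whole piece within \<open>X\<close>, so a fibre
      of \<open>h\<close> is contained in its label.\<close>
    define h where "h x = (if x \<in> S then {x} else K.scc_of x \<inter> X)" for x
    have in_h: "x \<in> h x" if "x \<in> X" for x
      using that K.in_scc_of_self[of x] by (auto simp: h_def vK V_def)
    show False
    \<comment> \<open>A singleton piece is at most half of \<open>X\<close> only if
      \<open>card X \<ge> 2\<close>. Otherwise \<open>f < 1\<close> makes \<open>S\<close> empty,
      and the component of the only vertex of \<open>X\<close> violates balance.\<close>
    proof (cases "card X \<ge> 2")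
      case False
      then have "cov ?Fam S = 0" using less cardX by simp
      then have "S = {}" using \<A> by auto
      obtain x where x: "x \<in> X" using cardX assms(7) by fastforce
      then have "x \<in> K.scc_of x \<inter> X" using in_h[of x] \<open>S = {}\<close> by (simp add: h_def)
      then have "0 < card (K.scc_of x \<inter> X)" using finX by (auto simp: card_gt_0_iff)
      with small[of x] x \<open>S = {}\<close> False show False by simp
    next
      case True
      have "2 * card {y \<in> X. h y = h x} \<le> card X" if "x \<in> X" for x
      proof -
        have "{y \<in> X. h y = h x} \<subseteq> h x" using in_h by force
        moreover have "finite (h x)" using finX by (simp add: h_def)
        ultimately have "card {y \<in> X. h y = h x} \<le> card (h x)" by (rule card_mono[rotated])
        moreover have "2 * card (h x) \<le> card X" using small[of x] that True by (simp add: h_def)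
        ultimately show ?thesis by linarith
      qed
      moreover have "X \<noteq> {}" using True by auto
      ultimately obtain B where B: "card X \<le> 3 * card {x \<in> X. h x \<in> B}"
        "3 * card {x \<in> X. h x \<in> B} \<le> 2 * card X"
        using exists_balanced_union_of_fibres[OF finX] by blast
      obtain w where w: "w \<in> set ws" "crosses {x \<in> X. h x \<in> B} w" "\<not> hits (\<Union>\<A>) w"
        using cut[OF \<A>(1) _ _ B] less \<A>(3) by auto
      \<comment> \<open>Meeting \<open>S\<close> would mean meeting a member of the cover
        \<open>\<A>\<close>, which the sampled path avoids.\<close>
      have "set (Q w) \<inter> S = {}"
      proof (rule ccontr)
        assume "\<not> ?thesis"
        then obtain F where F: "F \<in> \<A>" "set (Q w) \<inter> F \<noteq> {}" using \<A>(4) by blast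
        then have "hits F w" using Qhits w(1) \<A>(1) by blast
        with F w(3) show False by (auto simp: hits_def)
      qed
      then have sub: "set (Q w) \<subseteq> V" "set (Q w) \<subseteq> V - S" using w(1) by (auto simp: V_def)
      have rev: "vwalk (rev (Q w)) G" using vwalk_rev_ex[OF sym_arcs] Q(1) w(1) by blast
      have walk: "vwalk (Q w) K" "vwalk (rev (Q w)) K"
        unfolding K_def H_def using Q(1)[OF w(1)] rev sub by (simp_all add: vwalk_induce_subgraph)
      have ne: "Q w \<noteq> []" using walk by auto
      let ?u = "fst w" and ?v = "fst (snd w)"
      have uv: "hd (Q w) = ?u" "last (Q w) = ?v" using Q(2,3) w(1) by auto
      then have "?u \<in> set (Q w)" "?v \<in> set (Q w)" using ne by (metis hd_in_set, metis last_in_set)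
      then have notS: "?u \<notin> S" "?v \<notin> S" using sub by auto
      \<comment> \<open>The walk and its reverse put both ends into one component of
        \<open>K\<close>, hence give them one label, although \<open>w\<close> crosses a union of
        fibres.\<close>
      have "?u \<rightarrow>\<^sup>*\<^bsub>K\<^esub> ?v" "?v \<rightarrow>\<^sup>*\<^bsub>K\<^esub> ?u"
        using walk uv ne hd_rev[of "Q w"] last_rev[of "Q w"] unfolding K.reachable_vwalk_conv by metis+
      then have "K.scc_of ?u = K.scc_of ?v"
        by (auto simp: K.scc_of_def intro: K.reachable_trans)
      then have "h ?u = h ?v" using notS by (simp add: h_def)
      moreover have "?u \<in> X" "?v \<in> X" using w(1) ws by (auto simp: triples_def)
      ultimately show False using w(2) by (simp add: crosses_def)
    qed
  qed
  ultimately show ?thesis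
    using H vH by (intro exI[of _ H]) (auto simp: V_def)
qed

end
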